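(* Let $\beta>0$ and $\epsilon>0$. In the singly periodic setting (cell $\mathcal{C}_1$) let $\{w_{n,1},\lambda_{n,1}\}_{n=1}^{N_q^1}$ be a quadrature of precision $\epsilon$ for $K_1^{west}$, and in the doubly periodic setting (cell $\mathcal{C}_2$) let $\{w_{n,2},\lambda_{n,2}\}_{n=1}^{N_q^2}$ be a quadrature of precision $\epsilon$ for $K_2^{west}$ (as defined in the context). Let $\mathbf{s}_j=(x'_j,y'_j)$, $j=1,\dots,N_S$, and $\mathbf{t}_l=(x_l,y_l)$, $l=1,\dots,N_T$, be sources and targets in the unit cell, and let $\mathbf{P}_k^{east}$ be the $N_T\times N_S$ matrix with entries $K_k^{east}(\mathbf{t}_l,\mathbf{s}_j)$, $k=1,2$. Put $\sigma_{n,k}=\sqrt{\lambda_{n,k}^2+\beta^2}$. Then $$\mathbf{P}_1^{east}=\operatorname{Re}\left(\mathbf{L}_1^{east}\mathbf{D}_1^{e/w}\mathbf{R}_1^{east}\right)+O(\epsilon),\qquad \mathbf{P}_2^{east}=\operatorname{Re}\left(\mathbf{L}_2^{east}\mathbf{D}_2^{east}\mathbf{R}_2^{east}\right)+O(\epsilon),$$ where, for $k=1,2$, $$\mathbf{L}_k^{east}(l,n)=e^{\sigma_{n,k}x_l}e^{i\lambda_{n,k}y_l},\qquad \mathbf{R}_k^{east}(n,j)=e^{-\sigma_{n,k}x'_j}e^{-i\lambda_{n,k}y'_j},$$ and $\mathbf{D}_1^{e/w}$, $\mathbf{D}_2^{east}=\overline{\mathbf{D}_2^{west}}$ are diagonal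 with $$\mathbf{D}_1^{e/w}(n,n)=\frac{1}{2\pi}\frac{w_{n,1}}{\sigma_{n,1}}\frac{e^{-2\sigma_{n,1}d}}{1-e^{-\sigma_{n,1}d}},$$ $$\mathbf{D}_2^{west}(n,n)=\frac{1}{2\pi}\frac{w_{n,2}}{\sigma_{n,2}}\frac{e^{-4\sigma_{n,2}d}}{1-e^{-\sigma_{n,2}d}}\left[e^{-\sigma_{n,2}\xi+i\lambda_{n,2}\eta}+e^{\sigma_{n,2}\xi-i\lambda_{n,2}\eta}+1\right].$$
   Context: $G(\mathbf{t},\mathbf{s})=\frac{1}{2\pi}K_0(\beta\|\mathbf{t}-\mathbf{s}\|)$, with $K_0$ the modified Bessel function of the second kind. Singly periodic setting: $d,\eta>0$, $\mathcal{C}_1=[-\tfrac d2,\tfrac d2]\times[-\tfrac\eta2,\tfrac\eta2]$, $K_1^{west}(\mathbf{t},\mathbf{s})=\sum_{m=-\infty}^{-2}G(\mathbf{t},\mathbf{s}+(md,0))$, $K_1^{east}(\mathbf{t},\mathbf{s})=\sum_{m=2}^{\infty}G(\mathbf{t},\mathbf{s}+(md,0))$. Doubly periodic setting: $d,\eta>0$, $\xi\in\mathbb{R}$, $d\ge\sqrt{\xi^2+\eta^2}$, $\mathbf{e}_1=(d,0)$, $\mathbf{e}_2=(\xi,\eta)$, $\mathcal{C}_2=\{x_1\mathbf{e}_1+x_2\mathbf{e}_2 : x_1,x_2\in[-\tfrac12,\tfrac12]\}$, $\mathbf{l}_{mn}=m\mathbf{e}_1+n\mathbf{e}_2$, $K_2^{west}(\mathbf{t},\mathbf{s})=\sum_{n=-1}^{1}\sum_{m=-\infty}^{-4}G(\mathbf{t},\mathbf{s}+\mathbf{l}_{mn})$,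 $K_2^{east}(\mathbf{t},\mathbf{s})=\sum_{n=-1}^{1}\sum_{m=4}^{\infty}G(\mathbf{t},\mathbf{s}+\mathbf{l}_{mn})$. For $\lambda\ge0$ put $\sigma=\sqrt{\lambda^2+\beta^2}$ and, with $\mathbf{t}=(x,y)$, $\mathbf{s}=(x',y')$, $$F_1(\lambda;\mathbf{t},\mathbf{s})=\frac{e^{-\sigma(x-x')}}{2\pi\sigma}e^{i\lambda(y-y')}\frac{e^{-2\sigma d}}{1-e^{-\sigma d}},$$ $$F_2(\lambda;\mathbf{t},\mathbf{s})=\frac{e^{-\sigma(x-x')}}{2\pi\sigma}e^{i\lambda(y-y')}\frac{e^{-4\sigma d}}{1-e^{-\sigma d}}\left[e^{-\sigma\xi+i\lambda\eta}+e^{\sigma\xi-i\lambda\eta}+1\right].$$ A quadrature of precision $\epsilon$ for $K_k^{west}$ consists of real weights $w_{n,k}$ and nodes $\lambda_{n,k}\ge0$, $n=1,\dots,N_q^k$, such that $\big|\operatorname{Re}\int_0^\infty F_k(\lambda;\mathbf{t},\mathbf{s})\,d\lambda-\operatorname{Re}\sum_{n}w_{n,k}F_k(\lambda_{n,k};\mathbf{t},\mathbf{s})\big|\le\epsilon$ for all $\mathbf{t},\mathbf{s}\in\mathcal{C}_k$. $O(\epsilon)$ denotes a matrix all of whose entries are bounded in absolute value by $C\epsilon$, with $C$ independent of $\epsilon$ and of the number and locations of sources and targets. The bar and $\operatorname{Re}$ are applied entrywise. *)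

theory Defs
  imports "HOL-Analysis.Analysis" "Jordan_Normal_Form.Matrix"
begin

hide_const (open) Finite_Cartesian_Product.mat

(* Modified Bessel function of the second kind of order nu, for positive argument:
   K_nu(x) = \int_0^oo exp(-x cosh u) cosh(nu u) du  (DLMF 10.32.9). *)
definition bessel_K :: "real \<Rightarrow> real \<Rightarrow> real" where
  "bessel_K \<nu> x = (LINT u:{0..}|lborel. exp (- x * cosh u) * cosh (\<nu> * u))"

(* Points of the plane have type real \<times> real, whose norm is the Euclidean one. *)
definition green :: "real \<Rightarrow> real \<times> real \<Rightarrow> real \<times> real \<Rightarrow> real" where
  "green \<beta> t s = 1 / (2 * pi) * bessel_K 0 (\<beta> * norm (t - s))"

definition cell1 :: "real \<Rightarrow> real \<Rightarrow> (real \<times> real) set" where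
  "cell1 d \<eta> = {- d / 2 .. d / 2} \<times> {- \<eta> / 2 .. \<eta> / 2}"

definition e1 :: "real \<Rightarrow> real \<times> real" where
  "e1 d = (d, 0)"

definition e2 :: "real \<Rightarrow> real \<Rightarrow> real \<times> real" where
  "e2 \<xi> \<eta> = (\<xi>, \<eta>)"

definition cell2 :: "real \<Rightarrow> real \<Rightarrow> real \<Rightarrow> (real \<times> real) set" where
  "cell2 d \<xi> \<eta> =
    {x1 *\<^sub>R e1 d + x2 *\<^sub>R e2 \<xi> \<eta> | x1 x2. x1 \<in> {- 1 / 2 .. 1 / 2} \<and> x2 \<in> {- 1 / 2 .. 1 / 2}}"

definition lattice_vec :: "real \<Rightarrow> real \<Rightarrow> real \<Rightarrow> int \<Rightarrow> int \<Rightarrow> real \<times> real" where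
  "lattice_vec d \<xi> \<eta> m n = of_int m *\<^sub>R e1 d + of_int n *\<^sub>R e2 \<xi> \<eta>"

definition K1_west :: "real \<Rightarrow> real \<Rightarrow> real \<times> real \<Rightarrow> real \<times> real \<Rightarrow> real" where
  "K1_west \<beta> d t s = (\<Sum>\<^sub>\<infinity>m\<in>{..-2::int}. green \<beta> t (s + (of_int m * d, 0)))"

definition K1_east :: "real \<Rightarrow> real \<Rightarrow> real \<times> real \<Rightarrow> real \<times> real \<Rightarrow> real" where
  "K1_east \<beta> d t s = (\<Sum>\<^sub>\<infinity>m\<in>{2::int..}. green \<beta> t (s + (of_int m * d, 0)))"

definition K2_west ::
    "real \<Rightarrow> real \<Rightarrow> real \<Rightarrow> real \<Rightarrow> real \<times> real \<Rightarrow> real \<times> real \<Rightarrow> real" where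
  "K2_west \<beta> d \<xi> \<eta> t s =
    (\<Sum>n\<in>{-1..1::int}. \<Sum>\<^sub>\<infinity>m\<in>{..-4::int}. green \<beta> t (s + lattice_vec d \<xi> \<eta> m n))"

definition K2_east ::
    "real \<Rightarrow> real \<Rightarrow> real \<Rightarrow> real \<Rightarrow> real \<times> real \<Rightarrow> real \<times> real \<Rightarrow> real" where
  "K2_east \<beta> d \<xi> \<eta> t s =
    (\<Sum>n\<in>{-1..1::int}. \<Sum>\<^sub>\<infinity>m\<in>{4::int..}. green \<beta> t (s + lattice_vec d \<xi> \<eta> m n))"

definition sigma :: "real \<Rightarrow> real \<Rightarrow> real" where
  "sigma \<beta> l = sqrt (l\<^sup>2 + \<beta>\<^sup>2)"

(* F1 and F2 are the integrands of the Sommerfeld (plane wave) representations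
   K1_west = Re (\int_0^oo F1 dl) and K2_west = Re (\int_0^oo F2 dl) on the respective cells;
   l is the integration variable. *)
definition F1 :: "real \<Rightarrow> real \<Rightarrow> real \<Rightarrow> real \<times> real \<Rightarrow> real \<times> real \<Rightarrow> complex" where
  "F1 \<beta> d l t s =
    (let \<sigma> = sigma \<beta> l in
      of_real (exp (- \<sigma> * (fst t - fst s)) / (2 * pi * \<sigma>))
      * exp (\<i> * of_real (l * (snd t - snd s)))
      * of_real (exp (- 2 * \<sigma> * d) / (1 - exp (- \<sigma> * d))))"

(* The bracket produced by the three lattice rows n = -1, 1, 0 (in this order). *)
definition row_factor :: "real \<Rightarrow> real \<Rightarrow> real \<Rightarrow> real \<Rightarrow> complex" where
  "row_factor \<beta> \<xi> \<eta> l =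
    (let \<sigma> = sigma \<beta> l in
      exp (of_real (- \<sigma> * \<xi>) + \<i> * of_real (l * \<eta>))
      + exp (of_real (\<sigma> * \<xi>) - \<i> * of_real (l * \<eta>)) + 1)"

definition F2 ::
    "real \<Rightarrow> real \<Rightarrow> real \<Rightarrow> real \<Rightarrow> real \<Rightarrow> real \<times> real \<Rightarrow> real \<times> real \<Rightarrow> complex" where
  "F2 \<beta> d \<xi> \<eta> l t s =
    (let \<sigma> = sigma \<beta> l in
      of_real (exp (- \<sigma> * (fst t - fst s)) / (2 * pi * \<sigma>))
      * exp (\<i> * of_real (l * (snd t - snd s)))
      * of_real (exp (- 4 * \<sigma> * d) / (1 - exp (- \<sigma> * d)))
      * row_factor \<beta> \<xi> \<eta> l)"

(* Quadrature with N weights w and nodes lam (indexed from 0) for \int_0^oo F(l; t, s) dl,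
   with error at most eps in the real part, uniformly for t, s in the cell C. *)
definition quadrature_of_precision ::
    "real \<Rightarrow> (real \<Rightarrow> real \<times> real \<Rightarrow> real \<times> real \<Rightarrow> complex) \<Rightarrow> (real \<times> real) set
      \<Rightarrow> nat \<Rightarrow> (nat \<Rightarrow> real) \<Rightarrow> (nat \<Rightarrow> real) \<Rightarrow> bool" where
  "quadrature_of_precision \<epsilon> F C N w lam \<longleftrightarrow>
    (\<forall>n<N. 0 \<le> lam n) \<and>
    (\<forall>t\<in>C. \<forall>s\<in>C.
      \<bar>Re (LINT l:{0..}|lborel. F l t s) - Re (\<Sum>n<N. of_real (w n) * F (lam n) t s)\<bar> \<le> \<epsilon>)"

definition quadrature_K1_west ::
    "real \<Rightarrow> real \<Rightarrow> real \<Rightarrow> real \<Rightarrow> nat \<Rightarrow> (nat \<Rightarrow> real) \<Rightarrow> (nat \<Rightarrow> real) \<Rightarrow> bool" where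
  "quadrature_K1_west \<beta> d \<eta> \<epsilon> N w lam \<longleftrightarrow>
    quadrature_of_precision \<epsilon> (F1 \<beta> d) (cell1 d \<eta>) N w lam"

definition quadrature_K2_west ::
    "real \<Rightarrow> real \<Rightarrow> real \<Rightarrow> real \<Rightarrow> real \<Rightarrow> nat \<Rightarrow> (nat \<Rightarrow> real) \<Rightarrow> (nat \<Rightarrow> real) \<Rightarrow> bool" where
  "quadrature_K2_west \<beta> d \<xi> \<eta> \<epsilon> N w lam \<longleftrightarrow>
    quadrature_of_precision \<epsilon> (F2 \<beta> d \<xi> \<eta>) (cell2 d \<xi> \<eta>) N w lam"

(* All matrices below are indexed from 0. *)
definition interaction_mat ::
    "(real \<times> real \<Rightarrow> real \<times> real \<Rightarrow> real) \<Rightarrow> nat \<Rightarrow> nat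
      \<Rightarrow> (nat \<Rightarrow> real \<times> real) \<Rightarrow> (nat \<Rightarrow> real \<times> real) \<Rightarrow> real mat" where
  "interaction_mat K NT NS t s = mat NT NS (\<lambda>(l, j). K (t l) (s j))"

definition L_east ::
    "real \<Rightarrow> nat \<Rightarrow> nat \<Rightarrow> (nat \<Rightarrow> real) \<Rightarrow> (nat \<Rightarrow> real \<times> real) \<Rightarrow> complex mat" where
  "L_east \<beta> NT N lam t =
    mat NT N (\<lambda>(l, n). of_real (exp (sigma \<beta> (lam n) * fst (t l)))
                      * exp (\<i> * of_real (lam n * snd (t l))))"

definition R_east ::
    "real \<Rightarrow> nat \<Rightarrow> nat \<Rightarrow> (nat \<Rightarrow> real) \<Rightarrow> (nat \<Rightarrow> real \<times> real) \<Rightarrow> complex mat" where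
  "R_east \<beta> N NS lam s =
    mat N NS (\<lambda>(n, j). of_real (exp (- sigma \<beta> (lam n) * fst (s j)))
                      * exp (- \<i> * of_real (lam n * snd (s j))))"

definition diagonal :: "nat \<Rightarrow> (nat \<Rightarrow> complex) \<Rightarrow> complex mat" where
  "diagonal N f = mat N N (\<lambda>(m, n). if m = n then f n else 0)"

definition D1_ew ::
    "real \<Rightarrow> real \<Rightarrow> nat \<Rightarrow> (nat \<Rightarrow> real) \<Rightarrow> (nat \<Rightarrow> real) \<Rightarrow> complex mat" where
  "D1_ew \<beta> d N w lam =
    diagonal N (\<lambda>n. let \<sigma> = sigma \<beta> (lam n) in
      of_real (1 / (2 * pi) * (w n / \<sigma>) * (exp (- 2 * \<sigma> * d) / (1 - exp (- \<sigma> * d)))))"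

definition D2_west ::
    "real \<Rightarrow> real \<Rightarrow> real \<Rightarrow> real \<Rightarrow> nat \<Rightarrow> (nat \<Rightarrow> real) \<Rightarrow> (nat \<Rightarrow> real) \<Rightarrow> complex mat" where
  "D2_west \<beta> d \<xi> \<eta> N w lam =
    diagonal N (\<lambda>n. let \<sigma> = sigma \<beta> (lam n) in
      of_real (1 / (2 * pi) * (w n / \<sigma>) * (exp (- 4 * \<sigma> * d) / (1 - exp (- \<sigma> * d))))
      * row_factor \<beta> \<xi> \<eta> (lam n))"

definition D2_east ::
    "real \<Rightarrow> real \<Rightarrow> real \<Rightarrow> real \<Rightarrow> nat \<Rightarrow> (nat \<Rightarrow> real) \<Rightarrow> (nat \<Rightarrow> real) \<Rightarrow> complex mat" where
  "D2_east \<beta> d \<xi> \<eta> N w lam = map_mat cnj (D2_west \<beta> d \<xi> \<eta> N w lam)"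

end

theory Submission
  imports Defs "HOL-Complex_Analysis.Cauchy_Integral_Theorem"
begin

text \<open>
  Since \<open>G\<close> is even, reflecting the lattice gives \<open>K_east(t, s) = K_west(s, t)\<close>, so a quadrature for
  the western sum, applied with source and target exchanged, also approximates the eastern sum; the
  factors \<open>L D R\<close> are the complex conjugates of the exchanged integrand, which have the same real
  part. This gives the constant \<open>1\<close>.

  It remains to represent the eastern sum as an integral. With \<open>X = r cos \<theta>\<close>, \<open>Y = r sin \<theta>\<close>,
  the substitution \<open>l = \<beta> sinh u\<close> turns the Sommerfeld integral into the real part of the integral
  of \<open>exp(-\<beta> r cosh z)\<close> along the half-line \<open>u - i\<theta>\<close>, \<open>u \<ge> 0\<close>. Shifting this half-line to the real
  axis yields \<open>K\<^sub>0(\<beta> r)\<close>: on the segment from \<open>0\<close> to \<open>-i\<theta>\<close> the integrand is real, so its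
  contribution is purely imaginary, and the segment at \<open>Re z = T\<close> contributes nothing as \<open>T\<close> grows.
  Summing the plane waves over a lattice row is a geometric series.
\<close>

section \<open>Exponential decay and improper integrals\<close>

lemma set_integrable_exp_minus:
  fixes c :: real
  assumes "c > 0"
  shows "set_integrable lborel {0..} (\<lambda>x. exp (- c * x))"
proof -
  have "(\<lambda>x. exp (- c * x)) absolutely_integrable_on {0..}"
    using assms by (intro nonnegative_absolutely_integrable_1 integrable_on_exp_minus_to_infinity) auto
  \<comment> \<open>\<open>absolutely_integrable_on\<close> refers to the completed measure; Borel
    measurability carries the statement over to \<open>lborel\<close>.\<close>
  moreover have "(\<lambda>x. indicator {0..} x *\<^sub>R exp (- c * x)) \<in> borel_measurable lborel"
    by measurable
  ultimately show ?thesis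
    unfolding set_integrable_def by (simp add: integrable_completion)
qed

text \<open>Integrability on the half-line makes the truncated integrals converge, and each of them
  is a difference of values of the primitive. No limit of \<open>F\<close> is presupposed, so two
  integrals can be compared through the limits of one primitive along different curves.\<close>

lemma FTC_tendsto_at_top:
  fixes F f :: "real \<Rightarrow> real"
  assumes int: "set_integrable lborel {0..} f"
    and deriv: "\<And>x. x \<ge> 0 \<Longrightarrow> (F has_real_derivative f x) (at x)"
  shows "((\<lambda>T. F T - F 0) \<longlongrightarrow> (LINT x:{0..}|lborel. f x)) at_top"
proof -
  have "((\<lambda>T. LINT x|lborel. indicator {..T} x *\<^sub>R (indicator {0..} x *\<^sub>R f x))
          \<longlongrightarrow> (LINT x|lborel. indicator {0..} x *\<^sub>R f x)) at_top"
    using int unfolding set_integrable_def by (intro tendsto_integral_at_top) auto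
  moreover have "(LINT x|lborel. indicator {..T} x *\<^sub>R (indicator {0..} x *\<^sub>R f x)) = F T - F 0"
    if "T \<ge> 0" for T
  proof -
    have int': "set_integrable lborel {0..T} f"
      using int by (rule set_integrable_subset) auto
    have "(LINT x|lborel. indicator {..T} x *\<^sub>R (indicator {0..} x *\<^sub>R f x)) = (LINT x:{0..T}|lborel. f x)"
      unfolding set_lebesgue_integral_def
      by (intro Bochner_Integration.integral_cong) (auto simp: indicator_def)
    also have "\<dots> = integral {0..T} f"
      using int' by (rule set_borel_integral_eq_integral(2))
    also have "(f has_integral F T - F 0) {0..T}"
      using that deriv
      by (intro fundamental_theorem_of_calculus)
         (auto simp flip: has_real_derivative_iff_has_vector_derivative intro: has_field_derivative_at_within)
    then have "integral {0..T} f = F T - F 0"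
      by (rule integral_unique)
    finally show ?thesis .
  qed
  ultimately show ?thesis
    unfolding set_lebesgue_integral_def
    by (elim Lim_transform_eventually) (auto intro: eventually_mono[OF eventually_ge_at_top[of 0]])
qed

lemma sigma_pos: "\<beta> > 0 \<Longrightarrow> sigma \<beta> l > 0"
  unfolding sigma_def by (intro real_sqrt_gt_zero add_nonneg_pos) auto

lemma sigma_ge:
  assumes "\<beta> > 0"
  shows "sigma \<beta> l \<ge> \<beta>" and "sigma \<beta> l \<ge> l"
  unfolding sigma_def using assms by (auto intro!: real_le_rsqrt)

lemma measurable_sigma [measurable]: "sigma \<beta> \<in> borel_measurable borel"
  unfolding sigma_def by measurable

text \<open>The two lower bounds on \<open>sigma\<close> are used in different places:
  \<open>\<beta>\<close> in the denominator, and \<open>l\<close> in the exponent, where it gives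
  decay because \<open>X > 0\<close>.\<close>

lemma set_integrable_plane_wave:
  assumes "\<beta> > 0" "X > 0"
  shows "set_integrable lborel {0..} (\<lambda>l. exp (- sigma \<beta> l * X) / sigma \<beta> l)"
proof (rule set_integrable_bound)
  show "set_integrable lborel {0..} (\<lambda>l. 1 / \<beta> * exp (- X * l))"
    using assms by (intro set_integrable_mult_right set_integrable_exp_minus) auto
  show "AE l in lborel. l \<in> {0..} \<longrightarrow>
      norm (exp (- sigma \<beta> l * X) / sigma \<beta> l) \<le> norm (1 / \<beta> * exp (- X * l))"
    using assms sigma_ge[OF assms(1)] sigma_pos[OF assms(1)]
    by (intro AE_I2) (auto intro!: frac_le simp: abs_of_pos mult.commute)
  show "set_borel_measurable lborel {0..} (\<lambda>l. exp (- sigma \<beta> l * X) / sigma \<beta> l)"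
    unfolding set_borel_measurable_def by measurable
qed

lemma set_integrable_exp_cosh:
  fixes a :: real
  assumes "a > 0"
  shows "set_integrable lborel {0..} (\<lambda>u. exp (- a * cosh u))"
proof (rule set_integrable_bound)
  show "set_integrable lborel {0..} (\<lambda>u. exp (- (a / 2) * u))"
    using assms by (intro set_integrable_exp_minus) auto
  have "cosh u \<ge> u / 2" for u :: real
  proof -
    have "u \<le> exp u" using exp_ge_add_one_self[of u] by linarith
    also have "\<dots> \<le> 2 * cosh u" by (simp add: cosh_def)
    finally show ?thesis by simp
  qed
  then show "AE u in lborel. u \<in> {0..} \<longrightarrow> norm (exp (- a * cosh u)) \<le> norm (exp (- (a / 2) * u))"
    using assms by (intro AE_I2) (auto simp: field_simps)
  show "set_borel_measurable lborel {0..} (\<lambda>u. exp (- a * cosh u))"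
    unfolding set_borel_measurable_def cosh_def by measurable
qed

section \<open>The Sommerfeld integral for K_0\<close>

text \<open>On the shifted half-line the real part of \<open>cosh\<close> controls the decay of the
  integrand and the imaginary part its oscillation.\<close>

lemma cosh_rotated:
  "cosh (of_real u - \<i> * of_real \<theta>) =
    of_real (cosh u * cos \<theta>) - \<i> * of_real (sinh u * sin \<theta>)"
  by (simp add: complex_eq_iff cosh_def sinh_def Re_exp Im_exp algebra_simps)

lemma sommerfeld:
  assumes "\<beta> > 0" "X > 0"
  shows "bessel_K 0 (\<beta> * sqrt (X\<^sup>2 + Y\<^sup>2)) =
    (LINT l:{0..}|lborel. exp (- sigma \<beta> l * X) / sigma \<beta> l * cos (l * Y))"
proof -
  define r \<theta> a where "r = sqrt (X\<^sup>2 + Y\<^sup>2)" and "\<theta> = arctan (Y / X)" and "a = \<beta> * r"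
  have r: "r > 0" unfolding r_def using assms by (intro real_sqrt_gt_zero add_pos_nonneg) auto
  have a: "a > 0" unfolding a_def using assms r by simp
  have q: "sqrt (1 + (Y / X)\<^sup>2) = r / X"
    using assms r by (intro real_sqrt_unique) (simp_all add: r_def power_divide divide_simps)
  have X: "X = r * cos \<theta>" and Y: "Y = r * sin \<theta>"
    using r assms by (simp_all add: \<theta>_def cos_arctan sin_arctan q)
  \<comment> \<open>\<open>X > 0\<close> keeps the angle strictly below a right angle, so the
    integrand still decays on the shifted half-line.\<close>
  have \<theta>: "\<bar>\<theta>\<bar> < pi / 2"
    using arctan_bounded[of "Y / X"] unfolding \<theta>_def by linarith
  have cos_pos: "cos \<theta> > 0" using X r assms by (simp add: zero_less_mult_iff)
  define g :: "complex \<Rightarrow> complex" where "g = (\<lambda>z. exp (- of_real a * cosh z))"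
  have g_eq: "g (of_real u - \<i> * of_real \<phi>) =
      of_real (exp (- a * (cosh u * cos \<phi>))) * exp (\<i> * of_real (a * (sinh u * sin \<phi>)))" for u \<phi>
    unfolding g_def cosh_rotated
    by (simp add: exp_of_real[symmetric] exp_add[symmetric] algebra_simps)
  have "g holomorphic_on UNIV"
    unfolding g_def cosh_def by (intro holomorphic_intros) 
  \<comment> \<open>An entire function has a global primitive. Path independence enters only here;
    below, contour shifts become differences of values of \<open>\<Phi>\<close>.\<close>
  then obtain \<Phi> where \<Phi>: "\<And>z. (\<Phi> has_field_derivative g z) (at z)"
    using holomorphic_convex_primitive'[of UNIV g] by auto
  define H where "H = (\<lambda>\<phi> u. Re (\<Phi> (of_real u - \<i> * of_real \<phi>)))"
  \<comment> \<open>Re \<open>\<Phi>\<close> is used as a primitive both along the shifted half-line and, composed with \<open>arsinh\<close>, on the \<open>l\<close>-axis, which avoids any substitution in improper integrals.\<close>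
  have H_u: "(H \<phi> has_real_derivative exp (- a * (cosh u * cos \<phi>)) * cos (a * (sinh u * sin \<phi>))) (at u)"
    for \<phi> u
  proof -
    have "((\<lambda>u. of_real u - \<i> * of_real \<phi>) has_vector_derivative 1) (at u)"
      by (auto intro!: derivative_eq_intros)
    from field_vector_diff_chain_at[OF this \<Phi>]
    have "((\<lambda>u. Re (\<Phi> (of_real u - \<i> * of_real \<phi>))) has_vector_derivative
        Re (g (of_real u - \<i> * of_real \<phi>))) (at u)"
      by (intro bounded_linear.has_vector_derivative[OF bounded_linear_Re]) (simp add: o_def)
    then show ?thesis
      by (simp add: H_def g_eq Re_exp has_real_derivative_iff_has_vector_derivative)
  qed
  \<comment> \<open>Moving the angle differentiates along \<open>-\<i>\<close>, and the real part of
    \<open>-\<i> * g\<close> is the imaginary part of \<open>g\<close>; hence the sine in place of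
    the cosine.\<close>
  have H_\<phi>: "((\<lambda>\<phi>. H \<phi> u) has_real_derivative exp (- a * (cosh u * cos \<phi>)) * sin (a * (sinh u * sin \<phi>))) (at \<phi>)"
    for \<phi> u
  proof -
    have "((\<lambda>\<phi>. of_real u - \<i> * of_real \<phi>) has_vector_derivative - \<i>) (at \<phi>)"
      by (auto intro!: derivative_eq_intros)
    from field_vector_diff_chain_at[OF this \<Phi>]
    have "((\<lambda>\<phi>. Re (\<Phi> (of_real u - \<i> * of_real \<phi>))) has_vector_derivative
        Re (- \<i> * g (of_real u - \<i> * of_real \<phi>))) (at \<phi>)"
      by (intro bounded_linear.has_vector_derivative[OF bounded_linear_Re]) (simp add: o_def)
    then show ?thesis
      by (simp add: H_def g_eq Im_exp has_real_derivative_iff_has_vector_derivative)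
  qed
  have K: "((\<lambda>T. H 0 T - H 0 0) \<longlongrightarrow> bessel_K 0 a) at_top"
    using FTC_tendsto_at_top[OF set_integrable_exp_cosh[OF a], of "H 0"] H_u[of 0]
    by (simp add: bessel_K_def)
  \<comment> \<open>At \<open>u = 0\<close> the factor \<open>sinh u\<close> vanishes, so the
    derivative in the angle is zero.\<close>
  have H0: "H \<theta> 0 = H 0 0"
    using DERIV_isconst_all[of "\<lambda>\<phi>. H \<phi> 0"] H_\<phi>[where u = 0] by auto
  \<comment> \<open>Mean value bound in the angle: between \<open>-\<bar>\<theta>\<bar>\<close> and
    \<open>\<bar>\<theta>\<bar>\<close> the cosine is at least \<open>cos \<theta>\<close>, so the
    end segment is dominated uniformly. The symmetric interval covers both signs of
    \<open>\<theta>\<close>.\<close>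
  have bound: "\<bar>H \<theta> T - H 0 T\<bar> \<le> exp (- (a * cos \<theta>) * cosh T) * \<bar>\<theta>\<bar>" for T
  proof -
    have "norm (H \<theta> T - H 0 T) \<le> exp (- (a * cos \<theta>) * cosh T) * norm (\<theta> - 0)"
    proof (rule field_differentiable_bound[of "{-\<bar>\<theta>\<bar>..\<bar>\<theta>\<bar>}"])
      fix \<phi> assume "\<phi> \<in> {-\<bar>\<theta>\<bar>..\<bar>\<theta>\<bar>}"
      then have "cos \<bar>\<phi>\<bar> \<ge> cos \<bar>\<theta>\<bar>"
        using \<theta> by (intro cos_monotone_0_pi_le) auto
      then have "exp (- a * (cosh T * cos \<phi>)) \<le> exp (- (a * cos \<theta>) * cosh T)"
        using a by (simp add: mult.commute mult.left_commute mult_left_mono)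
      from mult_mono[OF this abs_sin_le_one[of "a * (sinh T * sin \<phi>)"]]
      show "norm (exp (- a * (cosh T * cos \<phi>)) * sin (a * (sinh T * sin \<phi>)))
            \<le> exp (- (a * cos \<theta>) * cosh T)"
        by (simp add: abs_mult)
    qed (use has_field_derivative_at_within[OF H_\<phi>] in auto)
    then show ?thesis by simp
  qed
  have "filterlim (\<lambda>T. - (a * cos \<theta>) * cosh T) at_bot at_top"
    by (rule filterlim_tendsto_neg_mult_at_bot[OF tendsto_const _ cosh_real_at_top]) (use a cos_pos in simp)
  from tendsto_mult_left_zero[OF filterlim_compose[OF exp_at_bot this]]
  have "((\<lambda>T. exp (- (a * cos \<theta>) * cosh T) * \<bar>\<theta>\<bar>) \<longlongrightarrow> 0) at_top" .
  then have "((\<lambda>T. H \<theta> T - H 0 T) \<longlongrightarrow> 0) at_top"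
    by (rule Lim_null_comparison[rotated]) (use bound in simp)
  from tendsto_add[OF this K]
  have "((\<lambda>T. H \<theta> T - H \<theta> 0) \<longlongrightarrow> bessel_K 0 a) at_top" by (simp add: H0)
  \<comment> \<open>The change of variable \<open>l = \<beta> * sinh u\<close>, read as a
    reparametrization of the limit.\<close>
  moreover have "filterlim (\<lambda>l. arsinh (l / \<beta>)) at_top at_top"
    using filterlim_compose[OF arsinh_real_at_top
        filterlim_tendsto_pos_mult_at_top[OF tendsto_const _ filterlim_ident, of "1 / \<beta>"]] assms
    by simp
  ultimately have 1: "((\<lambda>l. H \<theta> (arsinh (l / \<beta>)) - H \<theta> 0) \<longlongrightarrow> bessel_K 0 a) at_top"
    by (rule filterlim_compose)
  have "((\<lambda>l. H \<theta> (arsinh (l / \<beta>)) - H \<theta> (arsinh (0 / \<beta>))) \<longlongrightarrow>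
     (LINT l:{0..}|lborel. exp (- sigma \<beta> l * X) / sigma \<beta> l * cos (l * Y))) at_top"
  proof (rule FTC_tendsto_at_top)
    show "set_integrable lborel {0..} (\<lambda>l. exp (- sigma \<beta> l * X) / sigma \<beta> l * cos (l * Y))"
    proof (rule set_integrable_bound[OF set_integrable_plane_wave[OF assms]])
      show "AE l in lborel. l \<in> {0..} \<longrightarrow> norm (exp (- sigma \<beta> l * X) / sigma \<beta> l * cos (l * Y))
          \<le> norm (exp (- sigma \<beta> l * X) / sigma \<beta> l)"
        unfolding norm_mult by (intro AE_I2 impI mult_left_le) auto
    qed (simp add: set_borel_measurable_def)
    fix l :: real
    \<comment> \<open>This is \<open>cosh u = sigma \<beta> l / \<beta>\<close> for
      \<open>u = arsinh (l / \<beta>)\<close>. It turns \<open>a * cosh u * cos \<theta>\<close>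
      into \<open>sigma \<beta> l * X\<close>, and the derivative of \<open>u\<close> into
      \<open>1 / sigma \<beta> l\<close>.\<close>
    have sqrt_eq: "sqrt ((l / \<beta>)\<^sup>2 + 1) = sigma \<beta> l / \<beta>"
      using assms sigma_pos[OF assms(1), of l]
      by (intro real_sqrt_unique) (simp_all add: sigma_def power_divide divide_simps)
    have "((\<lambda>l. arsinh (l / \<beta>)) has_real_derivative 1 / sqrt ((l / \<beta>)\<^sup>2 + 1) * (1 / \<beta>)) (at l)"
      by (rule DERIV_chain2[OF arsinh_real_has_field_derivative])
        (use assms in \<open>auto intro!: derivative_eq_intros\<close>)
    from DERIV_chain2[OF H_u[of \<theta>] this]
    show "((\<lambda>l. H \<theta> (arsinh (l / \<beta>))) has_real_derivative
        exp (- sigma \<beta> l * X) / sigma \<beta> l * cos (l * Y)) (at l)"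
    proof (rule DERIV_cong)
      show "exp (- a * (cosh (arsinh (l / \<beta>)) * cos \<theta>)) * cos (a * (sinh (arsinh (l / \<beta>)) * sin \<theta>)) *
          (1 / sqrt ((l / \<beta>)\<^sup>2 + 1) * (1 / \<beta>)) = exp (- sigma \<beta> l * X) / sigma \<beta> l * cos (l * Y)"
        unfolding X Y a_def cosh_arsinh_real sinh_arsinh_real sqrt_eq using assms
        by (simp add: mult_ac)
    qed
  qed
  with 1 show ?thesis
    by (auto simp: a_def r_def intro: tendsto_unique[OF trivial_limit_at_top_linorder])
qed

section \<open>Summation over one lattice row\<close>

text \<open>The offset to the nearest image of the row is \<open>(X, Y)\<close>; the last factor sums the images.\<close>
definition plane_wave :: "real \<Rightarrow> real \<Rightarrow> real \<Rightarrow> real \<Rightarrow> real \<Rightarrow> complex" where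
  "plane_wave \<beta> d X Y l =
    of_real (exp (- sigma \<beta> l * X) / (2 * pi * sigma \<beta> l)) * exp (\<i> * of_real (l * Y))
    * of_real (1 / (1 - exp (- sigma \<beta> l * d)))"

lemma bessel_K_0_nonneg: "bessel_K 0 x \<ge> 0"
  unfolding bessel_K_def set_lebesgue_integral_def
  by (intro Bochner_Integration.integral_nonneg) auto

text \<open>Expanding the last factor of \<open>plane_wave\<close> as a geometric series, the power
  \<open>k\<close> of the ratio only moves the offset \<open>X\<close> to \<open>X + k * d\<close>,
  so \<open>sommerfeld\<close> evaluates each term.\<close>

lemma plane_wave_series:
  assumes "\<beta> > 0" "X > 0" "d > 0"
  shows "set_integrable lborel {0..} (plane_wave \<beta> d X Y)" (is ?integrable)
    and "(\<lambda>k::nat. 1 / (2 * pi) * bessel_K 0 (\<beta> * sqrt ((X + real k * d)\<^sup>2 + Y\<^sup>2)))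
           sums Re (LINT l:{0..}|lborel. plane_wave \<beta> d X Y l)" (is ?sums)
proof -
  define p where "p = (\<lambda>l. exp (- sigma \<beta> l * X) / (2 * pi * sigma \<beta> l))"
  define q where "q = (\<lambda>l. exp (- sigma \<beta> l * d))"
  define h where "h = (\<lambda>k l. of_real (p l * q l ^ k) * exp (\<i> * of_real (l * Y)))"
  define f where "f = (\<lambda>k l. indicator {0..} l *\<^sub>R h k l)"
  have pos: "sigma \<beta> l > 0" for l
    using assms(1) by (rule sigma_pos)
  have p_nonneg: "p l \<ge> 0" for l
    unfolding p_def using pos[of l] by simp
  have q: "q l \<ge> 0" "q l < 1" "q l \<le> exp (- \<beta> * d)" for l
    using assms pos[of l] sigma_ge(1)[OF assms(1), of l] by (simp_all add: q_def)
  have pq: "p l * q l ^ k = exp (- sigma \<beta> l * (X + real k * d)) / sigma \<beta> l / (2 * pi)" for k l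
    by (simp add: p_def q_def exp_of_nat_mult[symmetric] exp_add[symmetric] algebra_simps)
  have p_int: "set_integrable lborel {0..} p"
    using set_integrable_mult_right[of "1 / (2 * pi)", OF set_integrable_plane_wave[OF assms(1,2)]]
    by (simp add: p_def)
  have [measurable]: "p \<in> borel_measurable borel" "q \<in> borel_measurable borel"
    unfolding p_def q_def by measurable
  have [measurable]: "h k \<in> borel_measurable borel" for k
    unfolding h_def by measurable
  have norm_h: "norm (h k l) = p l * q l ^ k" for k l
    using p_nonneg[of l] q[of l] by (simp add: h_def norm_mult norm_power abs_mult)
  \<comment> \<open>Since \<open>sigma\<close> is at least \<open>\<beta>\<close>, the ratio has a
    bound below 1 independent of \<open>l\<close>. The resulting geometric majorant justifies
    exchanging sum and integral.\<close>
  have norm_f_le: "norm (f k l) \<le> exp (- \<beta> * d) ^ k * (indicator {0..} l * p l)" for k l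
    using p_nonneg[of l] q[of l]
    by (auto simp: f_def norm_h indicator_def mult.commute[of "p l"] intro!: mult_right_mono power_mono)
  have indp_int: "integrable lborel (\<lambda>l. exp (- \<beta> * d) ^ k * (indicator {0..} l * p l))" for k
    using p_int by (intro integrable_mult_right) (simp add: set_integrable_def)
  have f_int: "integrable lborel (f k)" for k
    by (rule Bochner_Integration.integrable_bound[OF indp_int[of k]])
       (use norm_f_le[of k] order_trans[OF norm_f_le[of k] abs_ge_self] in \<open>auto simp: f_def\<close>)
  have exp_lt: "exp (- \<beta> * d) < 1"
    using assms by simp
  have sums: "(\<lambda>k. f k l) sums (indicator {0..} l *\<^sub>R plane_wave \<beta> d X Y l)" for l
  proof -
    have "(\<lambda>k. q l ^ k) sums (1 / (1 - q l))"
      using q[of l] by (intro geometric_sums) auto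
    from sums_of_real[OF this, where 'a = complex]
    have "(\<lambda>k. indicator {0..} l *\<^sub>R (of_real (p l) * exp (\<i> * of_real (l * Y)) * of_real (q l ^ k)))
      sums (indicator {0..} l *\<^sub>R (of_real (p l) * exp (\<i> * of_real (l * Y)) * of_real (1 / (1 - q l))))"
      by (intro sums_scaleR_right sums_mult)
    then show ?thesis
      by (simp add: f_def h_def plane_wave_def p_def q_def mult_ac)
  qed
  have AE_summable: "AE l in lborel. summable (\<lambda>k. norm (f k l))"
  proof (intro AE_I2)
    fix l
    show "summable (\<lambda>k. norm (f k l))"
    proof (rule summable_comparison_test')
      show "summable (\<lambda>k. exp (- \<beta> * d) ^ k * (indicator {0..} l * p l))"
        using exp_lt by (intro summable_mult2 summable_geometric) auto
    qed (use norm_f_le in simp)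
  qed
  have summable_int: "summable (\<lambda>k. LINT l|lborel. norm (f k l))"
  proof (rule summable_comparison_test')
    show "summable (\<lambda>k. exp (- \<beta> * d) ^ k * (LINT l|lborel. indicator {0..} l * p l))"
      using exp_lt by (intro summable_mult2 summable_geometric) auto
    fix k
    have "(LINT l|lborel. norm (f k l)) \<le> (LINT l|lborel. exp (- \<beta> * d) ^ k * (indicator {0..} l * p l))"
      using f_int indp_int norm_f_le by (intro integral_mono) auto
    then show "norm (LINT l|lborel. norm (f k l)) \<le> exp (- \<beta> * d) ^ k * (LINT l|lborel. indicator {0..} l * p l)"
      by simp
  qed
  have eq: "(\<lambda>l. \<Sum>k. f k l) = (\<lambda>l. indicator {0..} l *\<^sub>R plane_wave \<beta> d X Y l)"
    using sums by (auto simp: sums_iff)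
  show ?integrable
    unfolding set_integrable_def eq[symmetric]
    using f_int AE_summable summable_int by (rule integrable_suminf)
  have "(\<lambda>k. integral\<^sup>L lborel (f k)) sums (LINT l:{0..}|lborel. plane_wave \<beta> d X Y l)"
    unfolding set_lebesgue_integral_def eq[symmetric]
    using f_int AE_summable summable_int by (rule sums_integral)
  then have "(\<lambda>k. Re (integral\<^sup>L lborel (f k))) sums Re (LINT l:{0..}|lborel. plane_wave \<beta> d X Y l)"
    by (rule sums_Re)
  moreover have "Re (integral\<^sup>L lborel (f k)) =
      1 / (2 * pi) * bessel_K 0 (\<beta> * sqrt ((X + real k * d)\<^sup>2 + Y\<^sup>2))" for k
  proof -
    have "Re (integral\<^sup>L lborel (f k)) = (LINT l|lborel. Re (f k l))"
      using f_int by simp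
    also have "\<dots> = (LINT l:{0..}|lborel. 1 / (2 * pi) *
        (exp (- sigma \<beta> l * (X + real k * d)) / sigma \<beta> l * cos (l * Y)))"
      unfolding set_lebesgue_integral_def
      by (intro Bochner_Integration.integral_cong) (simp_all add: f_def h_def pq Re_exp)
    also have "\<dots> = 1 / (2 * pi) * bessel_K 0 (\<beta> * sqrt ((X + real k * d)\<^sup>2 + Y\<^sup>2))"
      unfolding set_integral_mult_right
      using assms by (subst sommerfeld) (auto intro: add_pos_nonneg)
    finally show ?thesis .
  qed
  ultimately show ?sums by simp
qed

text \<open>The positivity assumption puts every image strictly to the right of the target. The
  offset is taken as image minus target, which the evenness of \<open>green\<close> permits; this is
  where source and target change places. The pair \<open>(a, b)\<close> selects the lattice
  row.\<close>

lemma has_sum_green_east: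
  fixes a b :: real and m0 :: int
  assumes "\<beta> > 0" "d > 0" "fst s - fst t + a + of_int m0 * d > 0"
  shows "((\<lambda>m. green \<beta> t (s + (of_int m * d + a, b))) has_sum
      Re (LINT l:{0..}|lborel.
        plane_wave \<beta> d (fst s - fst t + a + of_int m0 * d) (snd s - snd t + b) l)) {m0..}"
proof -
  let ?X = "fst s - fst t + a + of_int m0 * d" and ?Y = "snd s - snd t + b"
  let ?g = "\<lambda>m. green \<beta> t (s + (of_int m * d + a, b))"
  define h where "h = (\<lambda>k. m0 + int k)"
  have h: "inj h" "range h = {m0..}"
  proof -
    show "inj h" by (auto simp: h_def inj_def)
    have "m \<in> range h" if "m \<ge> m0" for m
      using that by (intro image_eqI[of _ _ "nat (m - m0)"]) (auto simp: h_def)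
    then show "range h = {m0..}" by (auto simp: h_def)
  qed
  have gh: "?g (h k) = 1 / (2 * pi) * bessel_K 0 (\<beta> * sqrt ((?X + real k * d)\<^sup>2 + ?Y\<^sup>2))" for k
  proof -
    have "norm (t - (s + (of_int (h k) * d + a, b))) = sqrt ((?X + real k * d)\<^sup>2 + ?Y\<^sup>2)"
      unfolding norm_prod_def
      by (intro arg_cong[where f = sqrt] arg_cong2[where f = "(+)"])
         (simp_all add: h_def power2_eq_square algebra_simps)
    then show ?thesis by (simp add: green_def)
  qed
  have sums: "(?g \<circ> h) sums Re (LINT l:{0..}|lborel. plane_wave \<beta> d ?X ?Y l)"
    using plane_wave_series(2)[OF assms(1,3,2)] by (simp add: gh o_def)
  \<comment> \<open>Nonnegative terms make the convergence absolute, which the unordered sum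
    needs.\<close>
  moreover have "norm ((?g \<circ> h) k) = (?g \<circ> h) k" for k
    by (simp add: green_def bessel_K_0_nonneg)
  ultimately have "summable (\<lambda>k. norm ((?g \<circ> h) k))"
    by (simp add: sums_iff o_def)
  then have "((?g \<circ> h) has_sum Re (LINT l:{0..}|lborel. plane_wave \<beta> d ?X ?Y l)) UNIV"
    using sums by (rule norm_summable_imp_has_sum)
  then show ?thesis
    unfolding has_sum_reindex[OF h(1), of _ _, unfolded h(2)] .
qed

section \<open>The quadrature integrands as plane waves\<close>

lemma F1_plane_wave:
  "F1 \<beta> d l t s = plane_wave \<beta> d (fst t - fst s + 2 * d) (snd t - snd s) l"
proof -
  have "exp (- sigma \<beta> l * (fst t - fst s + 2 * d)) =
      exp (- sigma \<beta> l * (fst t - fst s)) * exp (- 2 * sigma \<beta> l * d)"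
    by (simp add: exp_add[symmetric] algebra_simps)
  \<comment> \<open>Stated for arbitrary factors, so that \<open>simp only\<close> can regroup the
    product without rewriting the exponentials.\<close>
  moreover have "of_real (p * q / c) * u * of_real (1 / r) = of_real (p / c) * u * of_real (q / r)"
    for p q c r :: real and u :: complex
    by simp
  ultimately show ?thesis
    unfolding F1_def plane_wave_def Let_def by (simp only:)
qed

text \<open>Translating the offset multiplies a plane wave by an exponential; the shifts by
  \<open>(\<xi>, \<eta>)\<close> and its negative produce the two exponentials of
  \<open>row_factor\<close>.\<close>

lemma plane_wave_shift:
  "plane_wave \<beta> d (X + a) (Y + b) l =
    plane_wave \<beta> d X Y l * exp (of_real (- sigma \<beta> l * a) + \<i> * of_real (l * b))"
proof -
  have "exp (- sigma \<beta> l * (X + a)) = exp (- sigma \<beta> l * X) * exp (- sigma \<beta> l * a)"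
    and "exp (\<i> * of_real (l * (Y + b))) = exp (\<i> * of_real (l * Y)) * exp (\<i> * of_real (l * b))"
    and "exp (of_real (- sigma \<beta> l * a) + \<i> * of_real (l * b)) =
      of_real (exp (- sigma \<beta> l * a)) * exp (\<i> * of_real (l * b))"
    by (simp_all add: exp_add[symmetric] exp_of_real[symmetric] algebra_simps)
  moreover have "of_real (p * q / c) * (u * v) * r = of_real (p / c) * u * r * (of_real q * v)"
    for p q c :: real and u v r :: complex
    by simp
  ultimately show ?thesis
    unfolding plane_wave_def by (simp only:)
qed

lemma F2_plane_wave:
  fixes t s :: "real \<times> real" and d :: real
  defines "X \<equiv> fst t - fst s + 4 * d" and "Y \<equiv> snd t - snd s"
  shows "F2 \<beta> d \<xi> \<eta> l t s = plane_wave \<beta> d (X + \<xi>) (Y + \<eta>) l + plane_wave \<beta> d (X - \<xi>) (Y - \<eta>) l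
      + plane_wave \<beta> d X Y l"
proof -
  have "exp (- sigma \<beta> l * X) = exp (- sigma \<beta> l * (fst t - fst s)) * exp (- 4 * sigma \<beta> l * d)"
    by (simp add: X_def exp_add[symmetric] algebra_simps)
  moreover have "of_real (p * q / c) * u * of_real (1 / r) = of_real (p / c) * u * of_real (q / r)"
    for p q c r :: real and u :: complex
    by simp
  ultimately have "F2 \<beta> d \<xi> \<eta> l t s = plane_wave \<beta> d X Y l * row_factor \<beta> \<xi> \<eta> l"
    unfolding F2_def plane_wave_def Let_def Y_def by (simp only:)
  then show ?thesis
    using plane_wave_shift[of \<beta> d X \<xi> Y \<eta> l] plane_wave_shift[of \<beta> d X "-\<xi>" Y "-\<eta>" l]
    by (simp add: row_factor_def Let_def algebra_simps)
qed

section \<open>Eastern sums as integrals with exchanged arguments\<close>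

lemma K1_east_eq:
  assumes "\<beta> > 0" "d > 0" "t \<in> cell1 d \<eta>" "s \<in> cell1 d \<eta>"
  shows "K1_east \<beta> d t s = Re (LINT l:{0..}|lborel. F1 \<beta> d l s t)"
proof -
  \<comment> \<open>First coordinates in the cell differ by at most \<open>d\<close>, so the nearest
    image is at horizontal distance at least \<open>d\<close>.\<close>
  have "fst s - fst t + 2 * d > 0"
    using assms by (auto simp: cell1_def)
  then show ?thesis
    using infsumI[OF has_sum_green_east[of \<beta> d s t 0 2 0]] assms
    by (simp add: K1_east_def F1_plane_wave)
qed

lemma cell2_fst_bound:
  assumes "d > 0" "t \<in> cell2 d \<xi> \<eta>"
  shows "\<bar>fst t\<bar> \<le> d / 2 + \<bar>\<xi>\<bar> / 2"
proof -
  obtain x1 x2 where t: "t = x1 *\<^sub>R e1 d + x2 *\<^sub>R e2 \<xi> \<eta>"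
    and x: "x1 \<in> {- 1 / 2 .. 1 / 2}" "x2 \<in> {- 1 / 2 .. 1 / 2}"
    using assms(2) unfolding cell2_def by blast
  have abs_x: "\<bar>x1\<bar> \<le> 1 / 2" "\<bar>x2\<bar> \<le> 1 / 2"
    using x unfolding atLeastAtMost_iff by linarith+
  have "\<bar>fst t\<bar> \<le> \<bar>x1\<bar> * d + \<bar>x2\<bar> * \<bar>\<xi>\<bar>"
    using abs_triangle_ineq[of "x1 * d" "x2 * \<xi>"] assms(1) by (simp add: t e1_def e2_def abs_mult)
  also have "\<dots> \<le> 1 / 2 * d + 1 / 2 * \<bar>\<xi>\<bar>"
    using abs_x assms(1) by (intro add_mono mult_right_mono) auto
  finally show ?thesis by simp
qed

lemma K2_east_eq:
  assumes "\<beta> > 0" "d > 0" "d \<ge> sqrt (\<xi>\<^sup>2 + \<eta>\<^sup>2)" "t \<in> cell2 d \<xi> \<eta>" "s \<in> cell2 d \<xi> \<eta>"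
  shows "K2_east \<beta> d \<xi> \<eta> t s = Re (LINT l:{0..}|lborel. F2 \<beta> d \<xi> \<eta> l s t)"
proof -
  define X Y where "X = fst s - fst t + 4 * d" and "Y = snd s - snd t"
  \<comment> \<open>The lattice condition enters here: first coordinates in the cell then differ by
    at most \<open>2 * d\<close>, so \<open>X\<close> is at least \<open>2 * d\<close> and
    \<open>X + \<xi>\<close>, \<open>X - \<xi>\<close> are at least \<open>d\<close>. All three rows
    thus start to the right of the target.\<close>
  have "\<bar>\<xi>\<bar> \<le> d"
    using real_sqrt_ge_abs1[of \<xi> \<eta>] assms(3) by linarith
  then have pos: "X > 0" "X + \<xi> > 0" "X - \<xi> > 0"
    using cell2_fst_bound[OF assms(2,4)] cell2_fst_bound[OF assms(2,5)] assms(2)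
    unfolding X_def by linarith+
  have row: "(\<Sum>\<^sub>\<infinity>m\<in>{4::int..}. green \<beta> t (s + lattice_vec d \<xi> \<eta> m n)) =
      Re (LINT l:{0..}|lborel. plane_wave \<beta> d (X + of_int n * \<xi>) (Y + of_int n * \<eta>) l)"
    if "X + of_int n * \<xi> > 0" for n
    using infsumI[OF has_sum_green_east[of \<beta> d s t "of_int n * \<xi>" 4 "of_int n * \<eta>"]] that assms
    by (simp add: X_def Y_def lattice_vec_def e1_def e2_def algebra_simps)
  note int = plane_wave_series(1)[OF assms(1) _ assms(2)]
  have "{-1..1::int} = {-1, 0, 1}" by auto
  then have "K2_east \<beta> d \<xi> \<eta> t s =
      Re ((LINT l:{0..}|lborel. plane_wave \<beta> d (X + \<xi>) (Y + \<eta>) l)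
        + (LINT l:{0..}|lborel. plane_wave \<beta> d (X - \<xi>) (Y - \<eta>) l)
        + (LINT l:{0..}|lborel. plane_wave \<beta> d X Y l))"
    using row[of "-1"] row[of 0] row[of 1] pos by (simp add: K2_east_def)
  also have "(LINT l:{0..}|lborel. plane_wave \<beta> d (X + \<xi>) (Y + \<eta>) l)
        + (LINT l:{0..}|lborel. plane_wave \<beta> d (X - \<xi>) (Y - \<eta>) l)
        + (LINT l:{0..}|lborel. plane_wave \<beta> d X Y l) = (LINT l:{0..}|lborel. F2 \<beta> d \<xi> \<eta> l s t)"
    unfolding F2_plane_wave X_def[symmetric] Y_def[symmetric]
    using set_integral_add(2)[OF set_integral_add(1)[OF int[OF pos(2)] int[OF pos(3)]] int[OF pos(1)]]
      set_integral_add(2)[OF int[OF pos(2)] int[OF pos(3)]]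
    by simp
  finally show ?thesis .
qed

section \<open>Matrix factors and the entrywise error\<close>

lemma index_mult_mat_sum:
  assumes "A \<in> carrier_mat m n" "B \<in> carrier_mat n k" "i < m" "j < k"
  shows "(A * B) $$ (i, j) = (\<Sum>x<n. A $$ (i, x) * B $$ (x, j))"
  using assms by (simp add: scalar_prod_def lessThan_atLeast0)

lemma diagonal_factorization_entry:
  assumes "l < NT" "j < NS"
  shows "(L_east \<beta> NT N lam t * diagonal N f * R_east \<beta> N NS lam s) $$ (l, j) =
    (\<Sum>n<N. L_east \<beta> NT N lam t $$ (l, n) * f n * R_east \<beta> N NS lam s $$ (n, j))"
proof -
  have L: "L_east \<beta> NT N lam t \<in> carrier_mat NT N" and R: "R_east \<beta> N NS lam s \<in> carrier_mat N NS"
    and D: "diagonal N f \<in> carrier_mat N N"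
    by (simp_all add: L_east_def R_east_def diagonal_def)
  have "(L_east \<beta> NT N lam t * diagonal N f) $$ (l, n) = L_east \<beta> NT N lam t $$ (l, n) * f n"
    if "n < N" for n
  proof -
    have "(L_east \<beta> NT N lam t * diagonal N f) $$ (l, n) =
        (\<Sum>i<N. if i = n then L_east \<beta> NT N lam t $$ (l, n) * f n else 0)"
      unfolding index_mult_mat_sum[OF L D assms(1) that]
      using that by (intro sum.cong) (auto simp: diagonal_def)
    then show ?thesis using that by simp
  qed
  then show ?thesis
    unfolding index_mult_mat_sum[OF mult_carrier_mat[OF L D] R assms] by simp
qed

text \<open>Common to both settings. The assumption \<open>f\<close> makes each summand of an entry
  of \<open>L D R\<close> the conjugate of a quadrature term with source and target exchanged, and
  real parts do not see the conjugation. The matrix \<open>E\<close> is the exact residual, so the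
  precision of the quadrature bounds it entrywise.\<close>

lemma east_factorization:
  assumes K: "\<And>t s. t \<in> C \<Longrightarrow> s \<in> C \<Longrightarrow> K t s = Re (LINT l:{0..}|lborel. F l s t)"
    and f: "\<And>n t s. n < N \<Longrightarrow>
      of_real (exp (sigma \<beta> (lam n) * fst t)) * exp (\<i> * of_real (lam n * snd t)) * f n
      * (of_real (exp (- sigma \<beta> (lam n) * fst s)) * exp (- \<i> * of_real (lam n * snd s)))
      = cnj (of_real (w n) * F (lam n) s t)"
    and quad: "quadrature_of_precision \<epsilon> F C N w lam"
    and s: "\<forall>j<NS. s j \<in> C" and t: "\<forall>l<NT. t l \<in> C"
  shows "\<exists>E \<in> carrier_mat NT NS. (\<forall>l<NT. \<forall>j<NS. \<bar>E $$ (l, j)\<bar> \<le> 1 * \<epsilon>) \<and>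
    interaction_mat K NT NS t s =
      map_mat Re (L_east \<beta> NT N lam t * diagonal N f * R_east \<beta> N NS lam s) + E"
proof -
  let ?P = "L_east \<beta> NT N lam t * diagonal N f * R_east \<beta> N NS lam s"
  define E where "E = Matrix.mat NT NS (\<lambda>(l, j). K (t l) (s j) - Re (?P $$ (l, j)))"
  have P: "Re (?P $$ (l, j)) = Re (\<Sum>n<N. of_real (w n) * F (lam n) (s j) (t l))"
    if "l < NT" "j < NS" for l j
  proof -
    have "?P $$ (l, j) = (\<Sum>n<N. cnj (of_real (w n) * F (lam n) (s j) (t l)))"
      unfolding diagonal_factorization_entry[OF that]
    proof (rule sum.cong[OF refl])
      fix n assume "n \<in> {..<N}"
      then show "L_east \<beta> NT N lam t $$ (l, n) * f n * R_east \<beta> N NS lam s $$ (n, j) =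
          cnj (of_real (w n) * F (lam n) (s j) (t l))"
        using that f[of n "t l" "s j", symmetric] by (simp add: L_east_def R_east_def)
    qed
    then show ?thesis by (simp add: cnj_sum[symmetric] del: cnj_sum)
  qed
  have "\<bar>E $$ (l, j)\<bar> \<le> 1 * \<epsilon>" if "l < NT" "j < NS" for l j
    using quad that s t K[of "t l" "s j"] P[OF that]
    by (simp add: quadrature_of_precision_def E_def)
  moreover have "interaction_mat K NT NS t s = map_mat Re ?P + E"
    by (rule eq_matI) (auto simp: interaction_mat_def E_def L_east_def R_east_def)
  ultimately show ?thesis
    by (intro bexI[of _ E]) (auto simp: E_def)
qed

lemma map_mat_cnj_diagonal: "map_mat cnj (diagonal N f) = diagonal N (\<lambda>n. cnj (f n))"
  by (rule eq_matI) (auto simp: diagonal_def)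

text \<open>Conjugation reverses the phase in \<open>y' - y\<close> but keeps the real exponential,
  which splits into an \<open>x\<close> factor and an \<open>x'\<close> factor. The remaining
  complex factor \<open>z\<close> appears conjugated on the left, whence the conjugate in
  \<open>D2_east\<close>.\<close>

lemma plane_wave_separation:
  fixes \<sigma> x x' l y y' w c :: real and z :: complex
  shows "of_real (exp (\<sigma> * x)) * exp (\<i> * of_real (l * y)) *
      (of_real (1 / (2 * pi) * (w / \<sigma>) * c) * cnj z) *
      (of_real (exp (- \<sigma> * x')) * exp (- \<i> * of_real (l * y'))) =
    cnj (of_real w * (of_real (exp (- \<sigma> * (x' - x)) / (2 * pi * \<sigma>)) *
      exp (\<i> * of_real (l * (y' - y))) * of_real c * z))"
proof -
  have "exp (- \<sigma> * (x' - x)) = exp (\<sigma> * x) * exp (- \<sigma> * x')"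
    by (simp add: exp_add[symmetric] algebra_simps)
  moreover have "cnj (exp (\<i> * of_real (l * (y' - y)))) =
      exp (\<i> * of_real (l * y)) * exp (- \<i> * of_real (l * y'))"
    by (simp add: exp_cnj exp_add[symmetric] algebra_simps)
  ultimately show ?thesis
    by (simp add: mult_ac)
qed

theorem corollary2:
  fixes \<beta> d \<eta> \<xi> :: real
  assumes "\<beta> > 0" and "d > 0" and "\<eta> > 0"
  shows
    "(\<exists>C::real. \<forall>\<epsilon>>0. \<forall>(N::nat) (w::nat \<Rightarrow> real) (lam::nat \<Rightarrow> real).
        quadrature_K1_west \<beta> d \<eta> \<epsilon> N w lam \<longrightarrow>
        (\<forall>(NS::nat) (NT::nat) (s::nat \<Rightarrow> real \<times> real) (t::nat \<Rightarrow> real \<times> real).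
          (\<forall>j<NS. s j \<in> cell1 d \<eta>) \<longrightarrow> (\<forall>l<NT. t l \<in> cell1 d \<eta>) \<longrightarrow>
          (\<exists>E \<in> carrier_mat NT NS.
            (\<forall>l<NT. \<forall>j<NS. \<bar>E $$ (l, j)\<bar> \<le> C * \<epsilon>) \<and>
            interaction_mat (K1_east \<beta> d) NT NS t s =
              map_mat Re (L_east \<beta> NT N lam t * D1_ew \<beta> d N w lam * R_east \<beta> N NS lam s) + E)))

     \<and>
     (d \<ge> sqrt (\<xi>\<^sup>2 + \<eta>\<^sup>2) \<longrightarrow>
      (\<exists>C::real. \<forall>\<epsilon>>0. \<forall>(N::nat) (w::nat \<Rightarrow> real) (lam::nat \<Rightarrow> real).
        quadrature_K2_west \<beta> d \<xi> \<eta> \<epsilon> N w lam \<longrightarrow>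
        (\<forall>(NS::nat) (NT::nat) (s::nat \<Rightarrow> real \<times> real) (t::nat \<Rightarrow> real \<times> real).
          (\<forall>j<NS. s j \<in> cell2 d \<xi> \<eta>) \<longrightarrow> (\<forall>l<NT. t l \<in> cell2 d \<xi> \<eta>) \<longrightarrow>
          (\<exists>E \<in> carrier_mat NT NS.
            (\<forall>l<NT. \<forall>j<NS. \<bar>E $$ (l, j)\<bar> \<le> C * \<epsilon>) \<and>
            interaction_mat (K2_east \<beta> d \<xi> \<eta>) NT NS t s =
              map_mat Re (L_east \<beta> NT N lam t * D2_east \<beta> d \<xi> \<eta> N w lam * R_east \<beta> N NS lam s) + E))))"
proof (intro conjI impI exI[of _ 1] allI)
  fix \<epsilon> :: real and N NS NT :: nat and w lam :: "nat \<Rightarrow> real" and s t :: "nat \<Rightarrow> real \<times> real"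
  assume "quadrature_K1_west \<beta> d \<eta> \<epsilon> N w lam"
    and "\<forall>j<NS. s j \<in> cell1 d \<eta>" "\<forall>l<NT. t l \<in> cell1 d \<eta>"
  then show "\<exists>E \<in> carrier_mat NT NS. (\<forall>l<NT. \<forall>j<NS. \<bar>E $$ (l, j)\<bar> \<le> 1 * \<epsilon>) \<and>
      interaction_mat (K1_east \<beta> d) NT NS t s =
        map_mat Re (L_east \<beta> NT N lam t * D1_ew \<beta> d N w lam * R_east \<beta> N NS lam s) + E"
    unfolding D1_ew_def quadrature_K1_west_def
  proof (intro east_factorization[where C = "cell1 d \<eta>" and F = "F1 \<beta> d" and w = w], goal_cases)
    case (2 n t s)
    \<comment> \<open>With a single row the complex factor \<open>z\<close> is 1, so the diagonal
      entries are real and need no conjugation.\<close>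
    show ?case
      using plane_wave_separation[of _ _ _ _ _ _ 1] by (simp add: F1_def Let_def)
  qed (simp_all add: K1_east_eq assms)
next
  fix \<epsilon> :: real and N NS NT :: nat and w lam :: "nat \<Rightarrow> real" and s t :: "nat \<Rightarrow> real \<times> real"
  assume "d \<ge> sqrt (\<xi>\<^sup>2 + \<eta>\<^sup>2)" "quadrature_K2_west \<beta> d \<xi> \<eta> \<epsilon> N w lam"
    and "\<forall>j<NS. s j \<in> cell2 d \<xi> \<eta>" "\<forall>l<NT. t l \<in> cell2 d \<xi> \<eta>"
  then show "\<exists>E \<in> carrier_mat NT NS. (\<forall>l<NT. \<forall>j<NS. \<bar>E $$ (l, j)\<bar> \<le> 1 * \<epsilon>) \<and>
      interaction_mat (K2_east \<beta> d \<xi> \<eta>) NT NS t s =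
        map_mat Re (L_east \<beta> NT N lam t * D2_east \<beta> d \<xi> \<eta> N w lam * R_east \<beta> N NS lam s) + E"
    unfolding D2_east_def D2_west_def map_mat_cnj_diagonal quadrature_K2_west_def
  proof (intro east_factorization[where C = "cell2 d \<xi> \<eta>" and F = "F2 \<beta> d \<xi> \<eta>" and w = w], goal_cases)
    case (2 n t s)
    show ?case
      \<comment> \<open>Conjugation is distributed only over the product ending in
        \<open>row_factor\<close>, so the outer conjugate on the right stays intact and the goal
        matches the separation identity.\<close>
      unfolding F2_def Let_def complex_cnj_mult[of _ "row_factor _ _ _ _"] complex_cnj_complex_of_real
      by (rule plane_wave_separation)
  qed (simp_all add: K2_east_eq assms)
qed

end
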